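(* Let $-\pi/2<\alpha<\pi/2$ and $0\le\beta<1$, and let $f\in\mathcal{S}_{\alpha}(\beta)$. Then the pre-Schwarzian norm satisfies $$\|P_f\|\le 4(1-\beta)\cos\alpha,$$ and this inequality is sharp: for each such $\alpha$ and $\beta$, the right-hand side cannot be replaced by a smaller number valid for all $f\in\mathcal{S}_{\alpha}(\beta)$.
   Context: $\mathbb{D}=\{z\in\mathbb{C}:|z|<1\}$ is the open unit disk. $\mathcal{A}$ is the class of analytic functions $f$ on $\mathbb{D}$ with $f(0)=0$ and $f'(0)=1$. For $-\pi/2<\alpha<\pi/2$ and $0\le\beta<1$, $\mathcal{S}_{\alpha}(\beta)$ is the class of $f\in\mathcal{A}$ that are locally univalent ($f'(z)\neq 0$ for all $z\in\mathbb{D}$, which is implicit in the following condition) and satisfy $$\operatorname{Re}\left\{e^{i\alpha}\left(1+\frac{zf''(z)}{f'(z)}\right)\right\}>\beta\cos\alpha\quad\text{for all } z\in\mathbb{D}.$$ The pre-Schwarzian derivative and pre-Schwarzian norm of a locally univalent analytic function $f$ on $\mathbb{D}$ are $$P_f(z)=\frac{f''(z)}{f'(z)},\qquad \|P_f\|=\sup_{z\in\mathbb{D}}(1-|z|^2)|P_f(z)|.$$ *)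

theory Defs
  imports "HOL-Complex_Analysis.Complex_Analysis"
begin

abbreviation unit_disk :: "complex set" where
  "unit_disk \<equiv> ball 0 1"

text \<open>Functions on the disk are represented by total functions on the complex plane; their values
  outside the disk are irrelevant, since the disk is open and \<open>deriv\<close> is local.\<close>

definition class_A :: "(complex \<Rightarrow> complex) set" where
  "class_A = {f. f analytic_on unit_disk \<and> f 0 = 0 \<and> deriv f 0 = 1}"

definition locally_univalent :: "(complex \<Rightarrow> complex) \<Rightarrow> bool" where
  "locally_univalent f \<longleftrightarrow> (\<forall>z\<in>unit_disk. deriv f z \<noteq> 0)"

definition class_S :: "real \<Rightarrow> real \<Rightarrow> (complex \<Rightarrow> complex) set" where
  "class_S \<alpha> \<beta> = {f \<in> class_A. locally_univalent f \<and>
     (\<forall>z\<in>unit_disk.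
        Re (exp (\<i> * complex_of_real \<alpha>) * (1 + z * deriv (deriv f) z / deriv f z)) > \<beta> * cos \<alpha>)}"

definition pre_Schwarzian :: "(complex \<Rightarrow> complex) \<Rightarrow> complex \<Rightarrow> complex" where
  "pre_Schwarzian f z = deriv (deriv f) z / deriv f z"

text \<open>The supremum is taken in the extended reals, so that it is \<open>\<infinity>\<close> for an unbounded family;
  the real-valued \<open>Sup\<close> would be unspecified there.\<close>

definition pre_Schwarzian_norm :: "(complex \<Rightarrow> complex) \<Rightarrow> ereal" where
  "pre_Schwarzian_norm f =
     (SUP z\<in>unit_disk. ereal ((1 - (norm z)\<^sup>2) * norm (pre_Schwarzian f z)))"

end

theory Submission
  imports Defs
begin

text \<open>
  Put \<open>c = (1 - \<beta>) cos \<alpha> > 0\<close> and \<open>u(z) = e\<^sup>i\<^sup>\<alpha> z P\<^sub>f(z)\<close>. The condition defining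
  the class says exactly that \<open>Re u > -c\<close> on the disk, and \<open>u(0) = 0\<close>. Thus \<open>u\<close> is
  subordinate to \<open>2cz / (1 - z)\<close>, the conformal map of the disk onto that half-plane, and the
  Schwarz lemma gives \<open>|u(z)| \<le> 2c|z| / (1 - |z|)\<close> (\<open>Re_gt_imp_norm_le\<close>). Dividing by \<open>|z|\<close>,
  \<open>(1 - |z|\<^sup>2) |P\<^sub>f(z)| \<le> 2c (1 + |z|) < 4c\<close>.

  The Schwarz bound for \<open>u\<close> becomes an equality on the positive radius when \<open>u\<close> is the half-plane map
  itself, that is, for the function with \<open>f'(z) = (1 - z)\<^sup>-\<^sup>k\<close>, \<open>k = 2c e\<^sup>-\<^sup>i\<^sup>\<alpha>\<close>. For it
  \<open>(1 - r\<^sup>2) |P\<^sub>f(r)| = 2c (1 + r)\<close>, which tends to \<open>4c\<close> as \<open>r\<close> tends to 1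
  (\<open>extremal_function\<close>).
\<close>

text \<open>The reflection \<open>u \<mapsto> - 2c - \<open>cnj\<close> u\<close> in the boundary of the half-plane \<open>Re u > -c\<close>
  exchanges 0 and \<open>-2c\<close>, and points of the half-plane are nearer to 0. Hence \<open>u / (u + 2c)\<close>
  maps the half-plane into the unit disk, and the Schwarz lemma applies to it.\<close>

lemma Re_gt_imp_norm_le:
  fixes u :: "complex \<Rightarrow> complex" and c :: real
  assumes hol: "u holomorphic_on ball 0 1" and u0: "u 0 = 0" and c: "c > 0"
    and Re: "\<And>z. z \<in> ball 0 1 \<Longrightarrow> Re (u z) > - c"
    and z: "z \<in> ball 0 1"
  shows "norm (u z) \<le> 2 * c * norm z / (1 - norm z)"
proof -
  have nz: "u \<zeta> + 2 * c \<noteq> 0" if "\<zeta> \<in> ball 0 1" for \<zeta>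
    using Re[OF that] c by (auto simp: complex_eq_iff)
  define w where "w = (\<lambda>z. u z / (u z + 2 * c))"
  have w_lt: "norm (w \<zeta>) < 1" if "norm \<zeta> < 1" for \<zeta>
  proof -
    have \<zeta>: "\<zeta> \<in> ball 0 1" using that by simp
    have "0 < 4 * c * (Re (u \<zeta>) + c)"
      using Re[OF \<zeta>] c by simp
    then have "(norm (u \<zeta>))\<^sup>2 < (norm (u \<zeta> + 2 * c))\<^sup>2"
      unfolding cmod_power2 by (simp add: power2_eq_square algebra_simps)
    then have "norm (u \<zeta>) < norm (u \<zeta> + 2 * c)"
      by (rule power2_less_imp_less) simp
    then show ?thesis
      using nz[OF \<zeta>] by (simp add: w_def norm_divide)
  qed
  have w_hol: "w holomorphic_on ball 0 1"
    unfolding w_def using nz by (intro holomorphic_intros hol) auto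
  have w_le: "norm (w z) \<le> norm z"
    using Schwarz_Lemma(1)[OF w_hol _ w_lt, of z] z u0 by (simp add: w_def)
  have z1: "norm z < 1" using z by simp
  have "w z * (u z + 2 * c) = u z"
    using nz[OF z] by (simp add: w_def)
  then have "u z = 2 * c * w z + u z * w z"
    by (simp add: algebra_simps)
  then have "norm (u z) \<le> norm (2 * c * w z) + norm (u z * w z)"
    by (metis norm_triangle_ineq)
  also have "\<dots> = 2 * c * norm (w z) + norm (u z) * norm (w z)"
    using c by (simp add: norm_mult)
  also have "\<dots> \<le> 2 * c * norm z + norm (u z) * norm z"
    using w_le c by (intro add_mono mult_left_mono) auto
  finally show ?thesis
    using z1 by (simp add: field_simps)
qed

lemma pre_Schwarzian_holomorphic:
  assumes "f analytic_on unit_disk" "locally_univalent f"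
  shows "pre_Schwarzian f holomorphic_on unit_disk"
proof -
  have "f holomorphic_on unit_disk"
    using assms(1) by (rule analytic_imp_holomorphic)
  then show ?thesis
    using assms(2) unfolding pre_Schwarzian_def[abs_def] locally_univalent_def
    by (intro holomorphic_intros) auto
qed

lemma class_S_pre_Schwarzian_le:
  fixes \<alpha> \<beta> :: real
  defines "c \<equiv> (1 - \<beta>) * cos \<alpha>"
  assumes f: "f \<in> class_S \<alpha> \<beta>" and c: "c > 0" and z: "z \<in> unit_disk"
  shows "norm (pre_Schwarzian f z) \<le> 2 * c / (1 - norm z)"
proof -
  let ?P = "pre_Schwarzian f"
  have hol: "?P holomorphic_on unit_disk"
    using f by (intro pre_Schwarzian_holomorphic) (auto simp: class_S_def class_A_def)
  define u where "u = (\<lambda>z. exp (\<i> * \<alpha>) * (z * ?P z))"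
  have u_hol: "u holomorphic_on ball 0 1"
    unfolding u_def by (intro holomorphic_intros hol)
  have Re_u: "Re (u \<zeta>) > - c" if "\<zeta> \<in> ball 0 1" for \<zeta>
  proof -
    have "\<beta> * cos \<alpha> < Re (exp (\<i> * \<alpha>) * (1 + \<zeta> * ?P \<zeta>))"
      using f that by (simp add: class_S_def pre_Schwarzian_def)
    also have "\<dots> = cos \<alpha> + Re (u \<zeta>)"
      unfolding u_def by (simp add: distrib_left Re_exp del: times_complex.sel)
    finally show ?thesis by (simp add: c_def algebra_simps)
  qed
  have away: "norm (?P \<zeta>) \<le> 2 * c / (1 - norm \<zeta>)" if "\<zeta> \<in> ball 0 1" "\<zeta> \<noteq> 0" for \<zeta>
  proof -
    have "norm \<zeta> * norm (?P \<zeta>) = norm (u \<zeta>)"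
      by (simp add: u_def norm_mult)
    also have "\<dots> \<le> norm \<zeta> * (2 * c / (1 - norm \<zeta>))"
      using Re_gt_imp_norm_le[OF u_hol _ c Re_u that(1)] by (simp add: u_def mult_ac)
    finally show ?thesis
      using that(2) by (metis mult_left_le_imp_le zero_less_norm_iff)
  qed
  show ?thesis
  proof (cases "z = 0")
    case True
    \<comment> \<open>Division by \<open>z\<close> loses the origin; there the estimate follows by continuity.\<close>
    have "isCont ?P 0"
      using holomorphic_on_imp_continuous_on[OF hol]
      by (rule continuous_on_interior) simp
    then have "(\<lambda>\<zeta>. norm (?P \<zeta>)) \<midarrow>0\<rightarrow> norm (?P 0)"
      by (intro tendsto_norm) (simp add: isCont_def)
    moreover have "(\<lambda>\<zeta>::complex. 2 * c / (1 - norm \<zeta>)) \<midarrow>0\<rightarrow> 2 * c / (1 - norm (0::complex))"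
      by (intro tendsto_intros) auto
    moreover have "\<forall>\<^sub>F \<zeta> in at 0. norm (?P \<zeta>) \<le> 2 * c / (1 - norm \<zeta>)"
      unfolding eventually_at using away by (intro exI[of _ 1]) auto
    ultimately have "norm (?P 0) \<le> 2 * c / (1 - norm (0::complex))"
      by (intro tendsto_le) auto
    then show ?thesis using True by simp
  qed (use away z in auto)
qed

lemma pre_Schwarzian_norm_le:
  assumes "f \<in> class_S \<alpha> \<beta>" "0 < (1 - \<beta>) * cos \<alpha>"
  shows "pre_Schwarzian_norm f \<le> ereal (4 * (1 - \<beta>) * cos \<alpha>)"
  unfolding pre_Schwarzian_norm_def
proof (intro SUP_least, unfold ereal_less_eq)
  fix z :: complex assume z: "z \<in> unit_disk"
  define c where "c = (1 - \<beta>) * cos \<alpha>"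
  have c: "c > 0" using assms(2) by (simp add: c_def)
  have z1: "norm z < 1" using z by simp
  have "(1 - (norm z)\<^sup>2) * norm (pre_Schwarzian f z) \<le> (1 - (norm z)\<^sup>2) * (2 * c / (1 - norm z))"
    using class_S_pre_Schwarzian_le[OF assms z] z1 unfolding c_def
    by (intro mult_left_mono) (auto simp: abs_square_le_1)
  also have "\<dots> = 2 * c * (1 + norm z)"
    using z1 by (simp add: power2_eq_square field_simps)
  also have "\<dots> \<le> 2 * c * 2"
    using z1 c by (intro mult_left_mono) auto
  finally show "(1 - (norm z)\<^sup>2) * norm (pre_Schwarzian f z) \<le> 4 * (1 - \<beta>) * cos \<alpha>"
    by (simp add: c_def mult_ac)
qed

lemma one_minus_nonpos_Reals:
  fixes z :: complex
  assumes "norm z < 1"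
  shows "1 - z \<notin> \<real>\<^sub>\<le>\<^sub>0"
  using assms complex_Re_le_cmod[of z] by (auto simp: complex_nonpos_Reals_iff)

text \<open>The equation \<open>f'' / f' = k / (1 - z)\<close> with \<open>f'(0) = 1\<close> integrates to the principal branch
  \<open>f'(z) = (1 - z)\<^sup>-\<^sup>k\<close>, an exponential and so without zeros; it has a primitive because the
  disk is convex.\<close>

lemma ex_pre_Schwarzian_eq:
  fixes k :: complex
  obtains f where "f \<in> class_A" "locally_univalent f"
    "\<And>z. z \<in> unit_disk \<Longrightarrow> pre_Schwarzian f z = k / (1 - z)"
proof -
  define g where "g = (\<lambda>z. exp (- k * Ln (1 - z)))"
  have g_deriv: "(g has_field_derivative g z * (k / (1 - z))) (at z)" if "z \<in> unit_disk" for z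
  proof -
    have "1 - z \<notin> \<real>\<^sub>\<le>\<^sub>0" using that by (intro one_minus_nonpos_Reals) simp
    then show ?thesis
      unfolding g_def by (auto intro!: derivative_eq_intros simp: divide_inverse mult_ac)
  qed
  then have "g holomorphic_on unit_disk"
    by (meson DERIV_subset holomorphic_onI field_differentiable_def subset_UNIV)
  then obtain F where F: "\<And>z. z \<in> unit_disk \<Longrightarrow> (F has_field_derivative g z) (at z within unit_disk)"
    using holomorphic_convex_primitive'[of unit_disk g] by auto
  define f where "f = (\<lambda>z. F z - F 0)"
  have f_deriv: "(f has_field_derivative g z) (at z)" if "z \<in> unit_disk" for z
    using F[OF that] that unfolding f_def
    by (auto intro!: derivative_eq_intros simp: at_within_open[OF _ open_ball])
  then have df: "deriv f z = g z" if "z \<in> unit_disk" for z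
    using that by (simp add: DERIV_imp_deriv)
  have ddf: "deriv (deriv f) z = g z * (k / (1 - z))" if "z \<in> unit_disk" for z
  proof -
    have "(deriv f has_field_derivative g z * (k / (1 - z))) (at z)"
      using has_field_derivative_transform_within_open[OF g_deriv[OF that] open_ball that]
      by (simp add: df)
    then show ?thesis by (rule DERIV_imp_deriv)
  qed
  show ?thesis
  proof
    have "f holomorphic_on unit_disk"
      using f_deriv by (meson DERIV_subset holomorphic_onI field_differentiable_def subset_UNIV)
    then show "f \<in> class_A"
      by (simp add: class_A_def analytic_on_open df) (simp add: f_def g_def)
    show "locally_univalent f"
      by (simp add: locally_univalent_def df g_def)
    show "pre_Schwarzian f z = k / (1 - z)" if "z \<in> unit_disk" for z
      using that by (simp add: pre_Schwarzian_def df ddf) (simp add: g_def)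
  qed
qed

text \<open>Because \<open>2 z / (1 - z) + 1 = (1 + z) / (1 - z)\<close> is the Cayley transform, this says that the
  Cayley transform maps the disk into the right half-plane.\<close>

lemma Re_half_plane_map:
  fixes z :: complex
  assumes "norm z < 1"
  shows "Re (z / (1 - z)) > - 1 / 2"
proof -
  have nz: "1 - z \<noteq> 0" using assms by auto
  have "norm z ^ 2 < 1" using assms by (simp add: power_less_one_iff)
  then have "0 < (norm (1 - z))\<^sup>2 + 2 * (Re z * (1 - Re z) - (Im z)\<^sup>2)"
    unfolding cmod_power2 by (simp add: power2_eq_square algebra_simps)
  moreover have "(norm (1 - z))\<^sup>2 > 0" using nz by simp
  moreover have "Re (z / (1 - z)) = (Re z * (1 - Re z) - (Im z)\<^sup>2) / (norm (1 - z))\<^sup>2"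
    unfolding Re_divide cmod_power2 by (simp add: power2_eq_square)
  ultimately show ?thesis
    by (simp only: pos_less_divide_eq) (simp add: algebra_simps)
qed

lemma extremal_function:
  fixes \<alpha> \<beta> :: real
  defines "c \<equiv> (1 - \<beta>) * cos \<alpha>"
  assumes c: "c > 0"
  obtains f where "f \<in> class_S \<alpha> \<beta>"
    "\<And>z. z \<in> unit_disk \<Longrightarrow> norm (pre_Schwarzian f z) = 2 * c / norm (1 - z)"
proof -
  obtain f where f: "f \<in> class_A" "locally_univalent f"
    and P: "\<And>z. z \<in> unit_disk \<Longrightarrow> pre_Schwarzian f z = 2 * c * exp (- (\<i> * \<alpha>)) / (1 - z)"
    using ex_pre_Schwarzian_eq[of "2 * c * exp (- (\<i> * \<alpha>))"] by blast
  have Re: "\<beta> * cos \<alpha> < Re (exp (\<i> * \<alpha>) * (1 + z * pre_Schwarzian f z))"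
    if z: "z \<in> unit_disk" for z
  proof -
    have "exp (\<i> * \<alpha>) * (1 + z * pre_Schwarzian f z)
        = exp (\<i> * \<alpha>) + (exp (\<i> * \<alpha>) * exp (- (\<i> * \<alpha>))) * of_real (2 * c) * (z / (1 - z))"
      by (simp add: P[OF z] distrib_left del: exp_minus_inverse)
    then have "exp (\<i> * \<alpha>) * (1 + z * pre_Schwarzian f z) = exp (\<i> * \<alpha>) + of_real (2 * c) * (z / (1 - z))"
      by (simp only: exp_minus_inverse mult_1)
    then have "Re (exp (\<i> * \<alpha>) * (1 + z * pre_Schwarzian f z)) = cos \<alpha> + 2 * c * Re (z / (1 - z))"
      by (simp only: plus_complex.sel times_complex.sel(1)[of "of_real (2 * c)"]
          Re_complex_of_real Im_complex_of_real) (simp add: Re_exp)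
    moreover have "2 * c * Re (z / (1 - z)) > 2 * c * (- 1 / 2)"
      using Re_half_plane_map[of z] z c by (intro mult_strict_left_mono) auto
    ultimately show ?thesis by (simp add: c_def algebra_simps)
  qed
  show ?thesis
  proof
    show "f \<in> class_S \<alpha> \<beta>"
      using f Re by (simp add: class_S_def pre_Schwarzian_def)
    show "norm (pre_Schwarzian f z) = 2 * c / norm (1 - z)" if "z \<in> unit_disk" for z
      using P[OF that] c by (simp add: norm_divide norm_mult)
  qed
qed

theorem theorem2p3:
  fixes \<alpha> \<beta> :: real
  assumes "- pi / 2 < \<alpha>" and "\<alpha> < pi / 2"
    and "0 \<le> \<beta>" and "\<beta> < 1"
  shows "(\<forall>f\<in>class_S \<alpha> \<beta>. pre_Schwarzian_norm f \<le> ereal (4 * (1 - \<beta>) * cos \<alpha>)) \<and>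
    (\<forall>C::real. (\<forall>f\<in>class_S \<alpha> \<beta>. pre_Schwarzian_norm f \<le> ereal C) \<longrightarrow>
       4 * (1 - \<beta>) * cos \<alpha> \<le> C)"
proof (intro conjI ballI allI impI)
  have "cos \<alpha> > 0"
    using assms(1,2) by (intro cos_gt_zero_pi) auto
  then have c: "0 < (1 - \<beta>) * cos \<alpha>"
    using assms(4) by simp
  show "pre_Schwarzian_norm f \<le> ereal (4 * (1 - \<beta>) * cos \<alpha>)" if "f \<in> class_S \<alpha> \<beta>" for f
    using that c by (rule pre_Schwarzian_norm_le)
  fix C :: real
  assume C: "\<forall>f\<in>class_S \<alpha> \<beta>. pre_Schwarzian_norm f \<le> ereal C"
  define c where "c = (1 - \<beta>) * cos \<alpha>"
  obtain f where f: "f \<in> class_S \<alpha> \<beta>"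
    and P: "\<And>z. z \<in> unit_disk \<Longrightarrow> norm (pre_Schwarzian f z) = 2 * c / norm (1 - z)"
    using extremal_function[OF c] unfolding c_def by blast
  have le: "2 * c * (1 + r) \<le> C" if r: "0 < r" "r < 1" for r :: real
  proof -
    have z: "complex_of_real r \<in> unit_disk" using r by simp
    have "ereal ((1 - (norm (of_real r :: complex))\<^sup>2) * norm (pre_Schwarzian f (of_real r))) \<le> ereal C"
      using C f SUP_upper[OF z, of "\<lambda>z. ereal ((1 - (norm z)\<^sup>2) * norm (pre_Schwarzian f z))"]
      unfolding pre_Schwarzian_norm_def by (meson order_trans)
    moreover have "norm (1 - complex_of_real r) = 1 - r"
      using r by (metis abs_of_pos diff_gt_0_iff_gt norm_of_real of_real_1 of_real_diff)
    ultimately have "(1 - r\<^sup>2) * (2 * c / (1 - r)) \<le> C"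
      using P[OF z] by simp
    moreover have "(1 - r\<^sup>2) * (2 * c / (1 - r)) = 2 * c * (1 + r)"
      using r by (simp add: power2_eq_square field_simps)
    ultimately show ?thesis by simp
  qed
  have "((\<lambda>r. 2 * c * (1 + r)) \<longlongrightarrow> 2 * c * (1 + 1)) (at_left 1)"
    by (intro tendsto_intros)
  moreover have "\<forall>\<^sub>F r in at_left (1::real). 2 * c * (1 + r) \<le> C"
    using eventually_at_left_real[of 0 "1::real"] le by (auto elim!: eventually_mono)
  ultimately have "2 * c * (1 + 1) \<le> C"
    by (intro tendsto_upperbound) auto
  then show "4 * (1 - \<beta>) * cos \<alpha> \<le> C"
    by (simp add: c_def algebra_simps)
qed

end
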